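(* Every real Jordan algebra of dimension $2$ is isomorphic to one of the following algebras, each given by its commutative product $\circ$ on a basis $\{e_1,e_2\}$ of $\mathbb{R}^2$: 1. $\psi_0$: $e_1\circ e_1=e_1$, $e_2\circ e_2=e_1$, $e_1\circ e_2=e_2$; 2. $\psi_1$: $e_1\circ e_1=e_1$, $e_2\circ e_2=0$, $e_1\circ e_2=e_2$; 3. $\psi_2$: $e_1\circ e_1=0$, $e_2\circ e_2=e_2$, $e_1\circ e_2=0$; 4. $\psi_3$: $e_1\circ e_1=e_2$, $e_2\circ e_2=0$, $e_1\circ e_2=0$; 5. $\psi_4$: $e_1\circ e_1=e_1$, $e_2\circ e_2=0$, $e_1\circ e_2=\frac12 e_2$; 6. $\psi_5$: $e_1\circ e_1=e_1$, $e_2\circ e_2=-e_1$, $e_1\circ e_2=e_2$. Moreover, $\psi_5$ is a simple Jordan algebra.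
   Context: A Jordan algebra law on $\mathbb{R}^n$ is a symmetric bilinear map $\varphi:\mathbb{R}^n\times\mathbb{R}^n\to\mathbb{R}^n$ such that $\varphi(\varphi(X,X),\varphi(X,Y))=\varphi(X,\varphi(\varphi(X,X),Y))$ for all $X,Y\in\mathbb{R}^n$; a real Jordan algebra of dimension $n$ is a pair $(\mathbb{R}^n,\varphi)$ with such a $\varphi$. Two laws $\varphi,\varphi'$ are isomorphic if $\varphi'(x,y)=f^{-1}(\varphi(f(x),f(y)))$ for all $x,y$, for some $f\in GL(n,\mathbb{R})$. An isotropic vector is a nonzero $v$ with $\varphi(v,v)=0$. An ideal is a linear subspace $I$ with $\varphi(I,\mathbb{R}^n)\subset I$. A Jordan algebra without isotropic vectors is called simple if it has no ideals other than $0$ and the whole algebra.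
   Formalization: The classification is proved for every real Jordan algebra of dimension 2 with nonzero product; the zero product is a Jordan algebra law on ℝ² isomorphic to none of ψ_0,…,ψ_5, so it has to be excluded. *)

theory Defs
  imports "HOL-Analysis.Analysis"
begin

type_synonym 'n law = "real ^ 'n \<Rightarrow> real ^ 'n \<Rightarrow> real ^ 'n"

definition jordan_law :: "('n::finite) law \<Rightarrow> bool" where
  "jordan_law \<phi> \<longleftrightarrow> bilinear \<phi> \<and> (\<forall>X Y. \<phi> X Y = \<phi> Y X) \<and>
     (\<forall>X Y. \<phi> (\<phi> X X) (\<phi> X Y) = \<phi> X (\<phi> (\<phi> X X) Y))"

definition isomorphic_laws :: "('n::finite) law \<Rightarrow> 'n law \<Rightarrow> bool" where
  "isomorphic_laws \<phi> \<phi>' \<longleftrightarrow>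
     (\<exists>f. linear f \<and> bij f \<and> (\<forall>x y. \<phi>' x y = inv f (\<phi> (f x) (f y))))"

definition isotropic :: "('n::finite) law \<Rightarrow> real ^ 'n \<Rightarrow> bool" where
  "isotropic \<phi> v \<longleftrightarrow> v \<noteq> 0 \<and> \<phi> v v = 0"

definition law_ideal :: "('n::finite) law \<Rightarrow> (real ^ 'n) set \<Rightarrow> bool" where
  "law_ideal \<phi> I \<longleftrightarrow> subspace I \<and> (\<forall>x\<in>I. \<forall>y. \<phi> x y \<in> I)"

text \<open>Simplicity is only defined for algebras without isotropic vectors, so anisotropy is part of
  the notion.\<close>

definition simple_jordan_law :: "('n::finite) law \<Rightarrow> bool" where
  "simple_jordan_law \<phi> \<longleftrightarrow> jordan_law \<phi> \<and> (\<nexists>v. isotropic \<phi> v) \<and>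
     (\<forall>I. law_ideal \<phi> I \<longrightarrow> I = {0} \<or> I = UNIV)"

abbreviation e1 :: "real ^ 2" where "e1 \<equiv> axis 1 1"
abbreviation e2 :: "real ^ 2" where "e2 \<equiv> axis 2 1"

text \<open>The commutative product with \<open>e1 \<circ> e1 = a\<close>, \<open>e2 \<circ> e2 = b\<close>,
  \<open>e1 \<circ> e2 = c\<close>, extended bilinearly.\<close>

definition table_law :: "real ^ 2 \<Rightarrow> real ^ 2 \<Rightarrow> real ^ 2 \<Rightarrow> 2 law" where
  "table_law a b c x y =
     (x $ 1 * y $ 1) *\<^sub>R a + (x $ 2 * y $ 2) *\<^sub>R b + (x $ 1 * y $ 2 + x $ 2 * y $ 1) *\<^sub>R c"

lemma table_law_basis:
  "table_law a b c e1 e1 = a" "table_law a b c e2 e2 = b"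
  "table_law a b c e1 e2 = c" "table_law a b c e2 e1 = c"
  by (simp_all add: table_law_def axis_def)

lemma bilinear_table_law: "bilinear (table_law a b c)"
  unfolding bilinear_def linear_iff
  by (simp add: table_law_def algebra_simps)

lemma table_law_unique:
  assumes "bilinear \<phi>" "\<And>x y. \<phi> x y = \<phi> y x"
  shows "\<phi> = table_law (\<phi> e1 e1) (\<phi> e2 e2) (\<phi> e1 e2)"
proof (intro ext)
  fix x y :: "real ^ 2"
  have x: "x = x $ 1 *\<^sub>R e1 + x $ 2 *\<^sub>R e2" and y: "y = y $ 1 *\<^sub>R e1 + y $ 2 *\<^sub>R e2"
    by (simp_all add: vec_eq_iff forall_2 axis_def)
  have "\<phi> x y = \<phi> (x $ 1 *\<^sub>R e1 + x $ 2 *\<^sub>R e2) (y $ 1 *\<^sub>R e1 + y $ 2 *\<^sub>R e2)"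
    using x y by simp
  also have "\<dots> = table_law (\<phi> e1 e1) (\<phi> e2 e2) (\<phi> e1 e2) x y"
    by (simp add: bilinear_ladd[OF assms(1)] bilinear_radd[OF assms(1)]
        bilinear_lmul[OF assms(1)] bilinear_rmul[OF assms(1)] assms(2)[of e2 e1]
        table_law_def algebra_simps)
  finally show "\<phi> x y = table_law (\<phi> e1 e1) (\<phi> e2 e2) (\<phi> e1 e2) x y" .
qed

definition "\<psi>\<^sub>0 = table_law e1 e1 e2"
definition "\<psi>\<^sub>1 = table_law e1 0 e2"
definition "\<psi>\<^sub>2 = table_law 0 e2 0"
definition "\<psi>\<^sub>3 = table_law e2 0 0"
definition "\<psi>\<^sub>4 = table_law e1 0 ((1/2) *\<^sub>R e2)"
definition "\<psi>\<^sub>5 = table_law e1 (- e1) e2"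

text \<open>The zero law is a Jordan law, but none of the six laws above is isomorphic to it, so the
  classification has to be read as one of nonzero laws.\<close>

lemma zero_law_not_listed:
  "jordan_law (\<lambda>_ _. 0 :: real ^ 2)"
  "\<forall>\<psi> \<in> {\<psi>\<^sub>0, \<psi>\<^sub>1, \<psi>\<^sub>2, \<psi>\<^sub>3, \<psi>\<^sub>4, \<psi>\<^sub>5}. \<not> isomorphic_laws (\<lambda>_ _. 0) \<psi>"
proof -
  show "jordan_law (\<lambda>_ _. 0 :: real ^ 2)"
    by (simp add: jordan_law_def bilinear_def linear_iff)
  have zero: "\<psi> x y = 0" if iso: "isomorphic_laws (\<lambda>_ _. 0) \<psi>" for \<psi> :: "2 law" and x y
  proof -
    obtain f :: "real ^ 2 \<Rightarrow> real ^ 2" where f: "linear f" "bij f" "\<psi> x y = inv f 0"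
      using iso unfolding isomorphic_laws_def by blast
    have "f 0 = 0" using f(1) by (rule linear_0)
    then show ?thesis using f by (metis bij_is_inj inv_f_f)
  qed
  have ne: "e1 \<noteq> 0" "e2 \<noteq> 0"
    by (simp_all add: axis_eq_0_iff)
  have "\<exists>x y. \<psi> x y \<noteq> 0" if "\<psi> \<in> {\<psi>\<^sub>0, \<psi>\<^sub>1, \<psi>\<^sub>2, \<psi>\<^sub>3, \<psi>\<^sub>4, \<psi>\<^sub>5}" for \<psi>
  proof -
    have "\<psi> e1 e1 \<noteq> 0 \<or> \<psi> e2 e2 \<noteq> 0"
      using that ne by (auto simp: \<psi>\<^sub>0_def \<psi>\<^sub>1_def \<psi>\<^sub>2_def \<psi>\<^sub>3_def \<psi>\<^sub>4_def \<psi>\<^sub>5_def table_law_basis)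
    then show ?thesis by blast
  qed
  then show "\<forall>\<psi> \<in> {\<psi>\<^sub>0, \<psi>\<^sub>1, \<psi>\<^sub>2, \<psi>\<^sub>3, \<psi>\<^sub>4, \<psi>\<^sub>5}. \<not> isomorphic_laws (\<lambda>_ _. 0) \<psi>"
    using zero by blast
qed

end

theory Submission
  imports Defs
begin

text \<open>If some \<open>v\<close> is linearly independent of \<open>v\<^sup>2\<close>, then \<open>v, v\<^sup>2\<close> is a basis and, since the Jordan
  identity gives \<open>v\<^sup>2 v\<^sup>2 = v v\<^sup>3\<close>, the whole product is determined by \<open>v\<^sup>3 = \<alpha> v + \<beta> v\<^sup>2\<close>: the
  algebra is \<open>t \<real>[t] / (t\<^sup>3 - \<beta> t\<^sup>2 - \<alpha> t)\<close>. For \<open>\<alpha> \<noteq> 0\<close> it has the unit \<open>(v\<^sup>2 - \<beta> v) / \<alpha>\<close>, and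
  completing the square leaves \<open>w\<^sup>2 \<in> {1, 0, -1}\<close>; for \<open>\<alpha> = 0\<close> it is \<open>\<psi>\<^sub>2\<close> or \<open>\<psi>\<^sub>3\<close>. If instead every
  \<open>v\<^sup>2\<close> is a multiple of \<open>v\<close>, then a nonzero product has an idempotent and the algebra is \<open>\<psi>\<^sub>4\<close>.\<close>

text \<open>\<open>det2 a b \<noteq> 0\<close> serves as the criterion for \<open>a\<close>,
  \<open>b\<close> to be a basis, so independence is checked by polynomial algebra.\<close>

definition det2 :: "real ^ 2 \<Rightarrow> real ^ 2 \<Rightarrow> real" where
  "det2 a b = a $ 1 * b $ 2 - a $ 2 * b $ 1"

text \<open>New second basis vectors are later written in this shape, even with a coefficient 0 or
  1, so that their independence follows by rewriting.\<close>

lemma det2_add_scale_right: "det2 a (s *\<^sub>R a + t *\<^sub>R b) = t * det2 a b"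
  by (simp add: det2_def algebra_simps)

text \<open>Cramer's rule supplies the coefficients.\<close>

lemma det2_nonzero_coordinates:
  assumes "det2 a b \<noteq> 0"
  obtains s t where "w = s *\<^sub>R a + t *\<^sub>R b"
proof
  show "w = (det2 w b / det2 a b) *\<^sub>R a + (det2 a w / det2 a b) *\<^sub>R b"
    using assms by (simp add: vec_eq_iff forall_2 field_simps) (simp add: det2_def algebra_simps)
qed

lemma det2_zero_multiple:
  assumes "det2 v w = 0" "v \<noteq> 0"
  obtains c where "w = c *\<^sub>R v"
proof (cases "v $ 1 = 0")
  case True
  with assms have "v $ 2 \<noteq> 0" by (simp add: vec_eq_iff forall_2)
  with True assms(1) have "w = (w $ 2 / v $ 2) *\<^sub>R v"
    by (simp add: vec_eq_iff forall_2 det2_def)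
  then show thesis by (rule that)
next
  case False
  with assms(1) have "w = (w $ 1 / v $ 1) *\<^sub>R v"
    by (simp add: vec_eq_iff forall_2 det2_def field_simps)
  then show thesis by (rule that)
qed

lemma obtain_det2_nonzero:
  assumes "u \<noteq> 0"
  obtains w where "det2 u w \<noteq> 0"
proof
  \<comment> \<open>The witness is \<open>u\<close> turned by a right angle.\<close>
  have "det2 u (vector [- (u $ 2), u $ 1]) = (u $ 1)\<^sup>2 + (u $ 2)\<^sup>2"
    by (simp add: det2_def power2_eq_square)
  with assms show "det2 u (vector [- (u $ 2), u $ 1]) \<noteq> 0"
    by (simp add: vec_eq_iff forall_2 sum_power2_eq_zero_iff)
qed

locale commutative_law =
  fixes \<phi> :: "2 law"
  assumes bil: "bilinear \<phi>" and commute: "\<phi> x y = \<phi> y x"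
begin

lemmas bilinear_simps =
  bilinear_ladd[OF bil] bilinear_radd[OF bil] bilinear_lsub[OF bil] bilinear_rsub[OF bil]
  bilinear_lmul[OF bil] bilinear_rmul[OF bil]

text \<open>Reduces each isomorphism to finding a basis \<open>a\<close>, \<open>b\<close> with the
  right products: the linear map sending \<open>e1\<close>, \<open>e2\<close> to \<open>a\<close>,
  \<open>b\<close> carries one table to the other.\<close>

lemma isomorphic_table_law:
  assumes "det2 a b \<noteq> 0"
    and "\<phi> a a = p $ 1 *\<^sub>R a + p $ 2 *\<^sub>R b"
    and "\<phi> b b = q $ 1 *\<^sub>R a + q $ 2 *\<^sub>R b"
    and "\<phi> a b = r $ 1 *\<^sub>R a + r $ 2 *\<^sub>R b"
  shows "isomorphic_laws \<phi> (table_law p q r)"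
proof -
  define f where "f x = x $ 1 *\<^sub>R a + x $ 2 *\<^sub>R b" for x :: "real ^ 2"
  have lin: "linear f"
    unfolding linear_iff f_def by (simp add: algebra_simps)
  have "x = 0" if "f x = 0" for x
  proof -
    have "det2 a (f x) = x $ 2 * det2 a b" "det2 (f x) b = x $ 1 * det2 a b"
      by (simp_all add: f_def det2_def algebra_simps)
    moreover have "det2 a (f x) = 0" "det2 (f x) b = 0"
      using that by (simp_all add: det2_def)
    ultimately show ?thesis
      using assms(1) by (simp add: vec_eq_iff forall_2)
  qed
  then have inj: "inj f"
    by (simp add: linear_injective_0[OF lin])
  then have "bij f"
    by (simp add: bij_def linear_injective_imp_surjective[OF lin])
  moreover have "f (table_law p q r x y) = \<phi> (f x) (f y)" for x y
    unfolding f_def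
    by (simp add: bilinear_simps commute[of b a] assms(2-4) table_law_def algebra_simps)
  ultimately show ?thesis
    unfolding isomorphic_laws_def using lin inj by (metis inv_f_f)
qed

lemma unital_cases:
  assumes "u \<noteq> 0" and unit: "\<And>x. \<phi> u x = x"
  shows "\<exists>\<psi> \<in> {\<psi>\<^sub>0, \<psi>\<^sub>1, \<psi>\<^sub>5}. isomorphic_laws \<phi> \<psi>"
proof -
  obtain w where w: "det2 u w \<noteq> 0"
    using assms(1) by (rule obtain_det2_nonzero)
  obtain p q where sq: "\<phi> w w = p *\<^sub>R u + q *\<^sub>R w"
    using w by (rule det2_nonzero_coordinates)
  \<comment> \<open>Subtracting \<open>(q / 2) *\<^sub>R u\<close> removes the \<open>w\<close>-term
    from the square.\<close>
  define c where "c = (- q / 2) *\<^sub>R u + 1 *\<^sub>R w"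
  define r where "r = p + q\<^sup>2 / 4"
  have unit': "\<phi> x u = x" for x
    using unit[of x] by (simp add: commute[of x u])
  have c: "det2 u c \<noteq> 0"
    unfolding c_def det2_add_scale_right using w by simp
  have cc: "\<phi> c c = r *\<^sub>R u"
    by (simp add: c_def r_def bilinear_simps unit unit' sq algebra_simps power2_eq_square
        flip: scaleR_add_left)
  show ?thesis
  proof (cases "r = 0")
    case True
    have "isomorphic_laws \<phi> \<psi>\<^sub>1"
      unfolding \<psi>\<^sub>1_def using c cc True
      by (intro isomorphic_table_law[of u c]) (auto simp: unit axis_def)
    then show ?thesis by blast
  next
    case False
    \<comment> \<open>Rescaling turns the square \<open>r *\<^sub>R u\<close> into plus or minus
      \<open>u\<close>.\<close>
    define d where "d = 0 *\<^sub>R u + (1 / sqrt \<bar>r\<bar>) *\<^sub>R c"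
    have d: "det2 u d \<noteq> 0"
      unfolding d_def det2_add_scale_right using c False by simp
    have "\<phi> d d = (r / \<bar>r\<bar>) *\<^sub>R u"
      by (simp add: d_def bilinear_simps cc)
    then consider "\<phi> d d = u" | "\<phi> d d = - u"
      using False by (cases "r > 0") auto
    then show ?thesis
    proof cases
      case 1
      with d have "isomorphic_laws \<phi> \<psi>\<^sub>0"
        unfolding \<psi>\<^sub>0_def
        by (intro isomorphic_table_law[of u d]) (auto simp: unit axis_def)
      then show ?thesis by blast
    next
      case 2
      with d have "isomorphic_laws \<phi> \<psi>\<^sub>5"
        unfolding \<psi>\<^sub>5_def
        by (intro isomorphic_table_law[of u d]) (auto simp: unit axis_def)
      then show ?thesis by blast
    qed
  qed
qed

lemma independent_square_cases:
  assumes v: "det2 v (\<phi> v v) \<noteq> 0"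
    and jordan: "\<phi> (\<phi> v v) (\<phi> v v) = \<phi> v (\<phi> (\<phi> v v) v)"
  shows "\<exists>\<psi> \<in> {\<psi>\<^sub>0, \<psi>\<^sub>1, \<psi>\<^sub>2, \<psi>\<^sub>3, \<psi>\<^sub>5}. isomorphic_laws \<phi> \<psi>"
proof -
  define z where "z = \<phi> v v"
  have vz: "det2 v z \<noteq> 0"
    using v by (simp add: z_def)
  have vv: "\<phi> v v = z"
    by (simp add: z_def)
  obtain \<alpha> \<beta> where cube: "\<phi> v z = \<alpha> *\<^sub>R v + \<beta> *\<^sub>R z"
    using vz by (rule det2_nonzero_coordinates)
  have cube': "\<phi> z v = \<alpha> *\<^sub>R v + \<beta> *\<^sub>R z"
    using cube by (simp add: commute[of z v])
  have zz: "\<phi> z z = \<alpha> *\<^sub>R z + \<beta> *\<^sub>R (\<alpha> *\<^sub>R v + \<beta> *\<^sub>R z)"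
    using jordan by (simp add: vv cube cube' bilinear_simps)
  consider "\<alpha> \<noteq> 0" | "\<alpha> = 0" "\<beta> \<noteq> 0" | "\<alpha> = 0" "\<beta> = 0"
    by blast
  then show ?thesis
  proof cases
    case 1
    define u where "u = (1 / \<alpha>) *\<^sub>R (z - \<beta> *\<^sub>R v)"
    have uv: "\<phi> u v = v" and uz: "\<phi> u z = z"
      using 1 by (simp_all add: u_def bilinear_simps vv cube cube' zz)
    have "\<phi> u x = x" for x
      using vz by (rule det2_nonzero_coordinates[of v z x]) (simp add: bilinear_simps uv uz)
    moreover have "u \<noteq> 0"
      using uv vz by (auto simp: det2_def bilinear_lzero[OF bil])
    ultimately show ?thesis
      using unital_cases[of u] by blast
  next
    case 2
    \<comment> \<open>The cubic is now t^2 (t - \<beta>): \<open>e\<close> is the idempotent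
      belonging to the simple root \<beta>, and \<open>a\<close> annihilates both \<open>v\<close>
      and \<open>z\<close>.\<close>
    define a where "a = v - (1 / \<beta>) *\<^sub>R z"
    define e where "e = (1 / \<beta>\<^sup>2) *\<^sub>R z"
    have "det2 a e = det2 v z / \<beta>\<^sup>2"
      by (simp add: a_def e_def det2_def algebra_simps diff_divide_distrib)
    then have "det2 a e \<noteq> 0"
      using vz 2 by simp
    moreover have "\<phi> a a = 0" "\<phi> e e = e" "\<phi> a e = 0"
      using 2 by (simp_all add: a_def e_def bilinear_simps vv cube cube' zz power2_eq_square)
    ultimately have "isomorphic_laws \<phi> \<psi>\<^sub>2"
      unfolding \<psi>\<^sub>2_def by (intro isomorphic_table_law[of a e]) (auto simp: axis_def)
    then show ?thesis by blast
  next
    case 3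
    then have "isomorphic_laws \<phi> \<psi>\<^sub>3"
      unfolding \<psi>\<^sub>3_def using vz vv cube zz
      by (intro isomorphic_table_law[of v z]) (auto simp: axis_def)
    then show ?thesis by blast
  qed
qed

lemma dependent_square_case:
  assumes dep: "\<And>v. det2 v (\<phi> v v) = 0" and nonzero: "\<phi> \<noteq> (\<lambda>_ _. 0)"
  shows "isomorphic_laws \<phi> \<psi>\<^sub>4"
proof -
  have eigen: "\<exists>c. \<phi> v v = c *\<^sub>R v" if "v \<noteq> 0" for v
    using det2_zero_multiple[OF dep that] by metis
  obtain v where v: "\<phi> v v \<noteq> 0"
  proof (rule ccontr)
    assume "\<not> thesis"
    then have sq0: "\<phi> x x = 0" for x using that by blast
    \<comment> \<open>Polarisation: a symmetric product is determined by its squares.\<close>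
    have "\<phi> x y = 0" for x y
    proof -
      have "\<phi> (x + y) (x + y) = \<phi> x y + \<phi> x y"
        by (simp add: bilinear_simps sq0[of x] sq0[of y] commute[of y x])
      then have "2 *\<^sub>R \<phi> x y = 0"
        unfolding sq0 scaleR_2 by (rule sym)
      then show ?thesis unfolding scaleR_eq_0_iff by simp
    qed
    then show False using nonzero by blast
  qed
  have v0: "v \<noteq> 0"
    using v bilinear_lzero[OF bil] by auto
  obtain \<kappa> where \<kappa>: "\<phi> v v = \<kappa> *\<^sub>R v" using eigen[OF v0] by blast
  with v have "\<kappa> \<noteq> 0" by auto
  define e where "e = (1 / \<kappa>) *\<^sub>R v"
  have ee: "\<phi> e e = e" and e0: "e \<noteq> 0"
    using \<open>\<kappa> \<noteq> 0\<close> v0 by (simp_all add: e_def bilinear_simps \<kappa>)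
  obtain w where w: "det2 e w \<noteq> 0"
    using e0 by (rule obtain_det2_nonzero)
  then have "w \<noteq> 0" by (auto simp: det2_def)
  then obtain \<mu> where ww: "\<phi> w w = \<mu> *\<^sub>R w" using eigen by blast
  obtain s t where ew: "\<phi> e w = s *\<^sub>R e + t *\<^sub>R w"
    using w by (rule det2_nonzero_coordinates)
  \<comment> \<open>Comparing \<open>(e + w)\<^sup>2 \<parallel> e + w\<close> with \<open>(e - w)\<^sup>2 \<parallel> e - w\<close> forces \<open>2 e w = \<mu> e + w\<close>.\<close>
  have "det2 (e + w) (\<phi> (e + w) (e + w)) = (\<mu> + 2 * t - 1 - 2 * s) * det2 e w"
    by (simp add: bilinear_simps ee ww ew commute[of w e]) (simp add: det2_def algebra_simps)
  then have plus: "\<mu> + 2 * t - 1 - 2 * s = 0"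
    using dep w by simp
  have "det2 (e - w) (\<phi> (e - w) (e - w)) = (\<mu> - 2 * t + 1 - 2 * s) * det2 e w"
    by (simp add: bilinear_simps ee ww ew commute[of w e]) (simp add: det2_def algebra_simps)
  then have minus: "\<mu> - 2 * t + 1 - 2 * s = 0"
    using dep w by simp
  have st: "s = \<mu> / 2" "t = 1 / 2"
    using plus minus by simp_all
  \<comment> \<open>Since 2 e w = \<mu> e + w, subtracting \<mu> e from \<open>w\<close> makes the
    square vanish and leaves an eigenvector of multiplication by \<open>e\<close>, with eigenvalue
    1/2.\<close>
  define b where "b = (- \<mu>) *\<^sub>R e + 1 *\<^sub>R w"
  have "det2 e b \<noteq> 0"
    unfolding b_def det2_add_scale_right using w by simp
  moreover have "\<phi> b b = 0" "\<phi> e b = (1 / 2) *\<^sub>R b"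
    by (simp_all add: b_def bilinear_simps ee ww ew commute[of w e] st vec_eq_iff algebra_simps)
  ultimately show ?thesis
    unfolding \<psi>\<^sub>4_def using ee by (intro isomorphic_table_law[of e b]) (auto simp: axis_def)
qed

end

lemma jordan_law_\<psi>\<^sub>5: "jordan_law \<psi>\<^sub>5"
  unfolding jordan_law_def \<psi>\<^sub>5_def
  by (auto simp: bilinear_table_law)
    (simp_all add: table_law_def vec_eq_iff forall_2 axis_def algebra_simps)

text \<open>The coordinates of the square are those of a complex square, v1^2 - v2^2 and 2 v1 v2,
  which vanish together only at 0.\<close>

lemma \<psi>\<^sub>5_not_isotropic: "\<not> isotropic \<psi>\<^sub>5 v"
  by (auto simp: isotropic_def \<psi>\<^sub>5_def table_law_def vec_eq_iff forall_2 axis_def)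

text \<open>A nonzero ideal contains an invertible element, hence the unit \<open>e1\<close>, hence
  everything.\<close>

lemma \<psi>\<^sub>5_ideal:
  assumes I: "law_ideal \<psi>\<^sub>5 I" and "I \<noteq> {0}"
  shows "I = UNIV"
proof -
  have "0 \<in> I" using I by (simp add: law_ideal_def subspace_0)
  with assms(2) obtain x where x: "x \<in> I" "x \<noteq> 0" by blast
  define N where "N = (x $ 1)\<^sup>2 + (x $ 2)\<^sup>2"
  have N: "N \<noteq> 0"
    using x(2) by (simp add: N_def vec_eq_iff forall_2 sum_power2_eq_zero_iff)
  \<comment> \<open>\<open>\<psi>\<^sub>5\<close> is the product of \<open>\<complex>\<close>, with inverse \<open>cnj x / \<bar>x\<bar>\<^sup>2\<close>.\<close>
  have "\<psi>\<^sub>5 x (vector [x $ 1 / N, - x $ 2 / N]) = e1"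
    using N by (simp add: \<psi>\<^sub>5_def table_law_def vec_eq_iff forall_2 axis_def field_simps)
      (simp add: N_def power2_eq_square)
  then have "e1 \<in> I" using I x(1) by (metis law_ideal_def)
  moreover have "\<psi>\<^sub>5 e1 y = y" for y
    by (simp add: \<psi>\<^sub>5_def table_law_def vec_eq_iff forall_2 axis_def)
  ultimately show ?thesis using I by (metis law_ideal_def UNIV_eq_I)
qed

theorem mainTheorem1:
  "(\<forall>\<phi> :: 2 law. jordan_law \<phi> \<and> \<phi> \<noteq> (\<lambda>_ _. 0) \<longrightarrow>
      (\<exists>\<psi> \<in> {\<psi>\<^sub>0, \<psi>\<^sub>1, \<psi>\<^sub>2, \<psi>\<^sub>3, \<psi>\<^sub>4, \<psi>\<^sub>5}. isomorphic_laws \<phi> \<psi>)) \<and>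
   simple_jordan_law \<psi>\<^sub>5"
proof (intro conjI allI impI)
  fix \<phi> :: "2 law"
  assume *: "jordan_law \<phi> \<and> \<phi> \<noteq> (\<lambda>_ _. 0)"
  then interpret commutative_law \<phi>
    unfolding jordan_law_def by unfold_locales blast+
  show "\<exists>\<psi> \<in> {\<psi>\<^sub>0, \<psi>\<^sub>1, \<psi>\<^sub>2, \<psi>\<^sub>3, \<psi>\<^sub>4, \<psi>\<^sub>5}. isomorphic_laws \<phi> \<psi>"
  proof (cases "\<exists>v. det2 v (\<phi> v v) \<noteq> 0")
    case True
    then obtain v where "det2 v (\<phi> v v) \<noteq> 0" by blast
    \<comment> \<open>This is the Jordan identity at \<open>X = Y = v\<close>.\<close>
    moreover have "\<phi> (\<phi> v v) (\<phi> v v) = \<phi> v (\<phi> (\<phi> v v) v)"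
      using * unfolding jordan_law_def by blast
    ultimately show ?thesis
      using independent_square_cases[of v] by blast
  next
    case False
    then show ?thesis
      using dependent_square_case * by blast
  qed
next
  show "simple_jordan_law \<psi>\<^sub>5"
    unfolding simple_jordan_law_def
    using jordan_law_\<psi>\<^sub>5 \<psi>\<^sub>5_not_isotropic \<psi>\<^sub>5_ideal by blast
qed

end
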